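(* Let $X\subset \mathbb{P}^5_{\mathbb{Q}}$ be the projective surface with homogeneous coordinates $[x:y:z:a:b:c]$ given by the equations $$x+y+z=0,\qquad xy+yz+zx=-a^2-b^2-c^2,\qquad xyz=2abc.$$ Then the set of rational points $X(\mathbb{Q})$ is Zariski dense in $X$. *)

theory Defs
  imports
    "HOL-Algebra.Algebraic_Closure_Type"
    "HOL-Library.Poly_Mapping"
    "HOL-Analysis.Finite_Cartesian_Product"
    "HOL-Analysis.Abstract_Topology"
begin

text \<open>
  A polynomial over \<open>'k\<close> in the variables \<open>'n\<close> is a finitely supported map from
  exponent vectors to coefficients.
\<close>

type_synonym ('n, 'k) mpoly = "('n \<Rightarrow>\<^sub>0 nat) \<Rightarrow>\<^sub>0 'k"

definition monom_value :: "('n::finite \<Rightarrow>\<^sub>0 nat) \<Rightarrow> 'k::comm_semiring_1 ^ 'n \<Rightarrow> 'k" where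
  "monom_value m v = (\<Prod>i\<in>UNIV. v $ i ^ Poly_Mapping.lookup m i)"

definition mpoly_value :: "('n::finite, 'k::comm_semiring_1) mpoly \<Rightarrow> 'k ^ 'n \<Rightarrow> 'k" where
  "mpoly_value f v = (\<Sum>m\<in>Poly_Mapping.keys f. Poly_Mapping.lookup f m * monom_value m v)"

definition monom_degree :: "('n::finite \<Rightarrow>\<^sub>0 nat) \<Rightarrow> nat" where
  "monom_degree m = (\<Sum>i\<in>UNIV. Poly_Mapping.lookup m i)"

definition homogeneous :: "('n::finite, 'k::comm_semiring_1) mpoly \<Rightarrow> bool" where
  "homogeneous f \<longleftrightarrow> (\<exists>d. \<forall>m\<in>Poly_Mapping.keys f. monom_degree m = d)"

text \<open>
  The point with homogeneous coordinates \<open>v \<noteq> 0\<close> is the set of all nonzero multiples of \<open>v\<close>.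
  For an index type with \<open>n + 1\<close> elements, \<open>proj_space\<close> is the set of \<open>'k\<close>-points of
  projective \<open>n\<close>-space.
\<close>

definition proj_point :: "'k::field ^ 'n \<Rightarrow> ('k ^ 'n) set" where
  "proj_point v = {c *s v | c. c \<noteq> 0}"

definition proj_space :: "('k::field ^ 'n) set set" where
  "proj_space = {proj_point v | v. v \<noteq> 0}"

definition zero_locus :: "('n::finite, 'k::field) mpoly set \<Rightarrow> ('k ^ 'n) set set" where
  "zero_locus S = {p \<in> proj_space. \<forall>f\<in>S. \<forall>v\<in>p. mpoly_value f v = 0}"

definition zariski_closed :: "('k::field ^ 'n::finite) set set \<Rightarrow> bool" where
  "zariski_closed Z \<longleftrightarrow> (\<exists>S. (\<forall>f\<in>S. homogeneous f) \<and> Z = zero_locus S)"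

definition zariski_topology :: "('k::field ^ 'n::finite) set topology" where
  "zariski_topology = topology (\<lambda>U. U \<subseteq> proj_space \<and> zariski_closed (proj_space - U))"

lemma monom_value_add: "monom_value (m + m') v = monom_value m v * monom_value m' v"
  by (simp add: monom_value_def lookup_add power_add prod.distrib)

lemma monom_degree_add: "monom_degree (m + m') = monom_degree m + monom_degree m'"
  by (simp add: monom_degree_def lookup_add sum.distrib)

lemma mpoly_value_superset:
  assumes "finite A" "Poly_Mapping.keys f \<subseteq> A"
  shows "mpoly_value f v = (\<Sum>m\<in>A. Poly_Mapping.lookup f m * monom_value m v)"
  unfolding mpoly_value_def
  by (rule sum.mono_neutral_left) (use assms in \<open>auto simp: in_keys_iff\<close>)

lemma mpoly_value_0 [simp]: "mpoly_value 0 v = 0"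
  by (simp add: mpoly_value_def)

lemma mpoly_value_1 [simp]: "mpoly_value 1 v = 1"
  by (subst mpoly_value_superset[of "{0}"])
     (auto simp: monom_value_def lookup_one in_keys_iff when_def split: if_splits)

lemma mpoly_value_add: "mpoly_value (f + g) v = mpoly_value f v + mpoly_value g v"
proof -
  let ?A = "Poly_Mapping.keys f \<union> Poly_Mapping.keys g"
  have "finite ?A" "Poly_Mapping.keys (f + g) \<subseteq> ?A"
    using keys_add[of f g] by auto
  then show ?thesis
    by (simp add: mpoly_value_superset[of ?A] lookup_add distrib_right sum.distrib)
qed

lemma mpoly_value_single: "mpoly_value (Poly_Mapping.single m c) v = c * monom_value m v"
  by (subst mpoly_value_superset[of "{m}"]) auto

lemma poly_mapping_sum_single:
  "f = (\<Sum>m\<in>Poly_Mapping.keys f. Poly_Mapping.single m (Poly_Mapping.lookup f m))"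
  by (rule poly_mapping_eqI) (auto simp: lookup_sum lookup_single when_def in_keys_iff)

lemma mpoly_value_sum: "mpoly_value (\<Sum>a\<in>A. F a) v = (\<Sum>a\<in>A. mpoly_value (F a) v)"
  by (induction A rule: infinite_finite_induct) (auto simp: mpoly_value_add)

lemma mpoly_value_mult: "mpoly_value (f * g) v = mpoly_value f v * mpoly_value g v"
proof -
  have "f * g = (\<Sum>m\<in>Poly_Mapping.keys f. \<Sum>m'\<in>Poly_Mapping.keys g.
      Poly_Mapping.single (m + m') (Poly_Mapping.lookup f m * Poly_Mapping.lookup g m'))"
    by (subst poly_mapping_sum_single[of f], subst poly_mapping_sum_single[of g])
       (simp add: sum_product mult_single)
  from arg_cong[OF this, of "\<lambda>h. mpoly_value h v"]
  have "mpoly_value (f * g) v = (\<Sum>m\<in>Poly_Mapping.keys f. \<Sum>m'\<in>Poly_Mapping.keys g.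
      Poly_Mapping.lookup f m * Poly_Mapping.lookup g m' * monom_value (m + m') v)"
    by (simp only: mpoly_value_sum mpoly_value_single)
  also have "\<dots> = mpoly_value f v * mpoly_value g v"
    unfolding mpoly_value_def sum_product
    by (intro sum.cong refl) (simp add: monom_value_add ac_simps)
  finally show ?thesis .
qed

lemma homogeneous_1: "homogeneous 1"
  by (auto simp: homogeneous_def)

lemma homogeneous_mult:
  assumes "homogeneous f" "homogeneous g"
  shows "homogeneous (f * g)"
proof -
  obtain d e where "\<forall>m\<in>Poly_Mapping.keys f. monom_degree m = d"
    "\<forall>m\<in>Poly_Mapping.keys g. monom_degree m = e"
    using assms by (auto simp: homogeneous_def)
  then have "\<forall>m\<in>Poly_Mapping.keys (f * g). monom_degree m = d + e"
    using keys_mult[of f g] by (fastforce simp: monom_degree_add)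
  then show ?thesis by (auto simp: homogeneous_def)
qed

lemma mpoly_value_scale:
  assumes "\<forall>m\<in>Poly_Mapping.keys f. monom_degree m = d"
  shows "mpoly_value f (c *s v) = c ^ d * mpoly_value f v"
proof -
  have "monom_value m (c *s v) = c ^ monom_degree m * monom_value m v" for m
    by (simp add: monom_value_def monom_degree_def power_mult_distrib prod.distrib power_sum)
  with assms show ?thesis
    by (simp add: mpoly_value_def sum_distrib_left mult.left_commute)
qed

lemma proj_point_self:
  fixes v :: "'a::field ^ 'n"
  shows "v \<in> proj_point v"
proof -
  have "v = 1 *s v" "(1::'a) \<noteq> 0" by simp_all
  then show ?thesis unfolding proj_point_def by blast
qed

lemma proj_point_vanish_iff:
  assumes "homogeneous f"
  shows "(\<forall>w\<in>proj_point v. mpoly_value f w = 0) \<longleftrightarrow> mpoly_value f v = 0"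
proof -
  obtain d where "\<forall>m\<in>Poly_Mapping.keys f. monom_degree m = d"
    using assms by (auto simp: homogeneous_def)
  note * = mpoly_value_scale[OF this]
  have "mpoly_value f w = 0" if "w \<in> proj_point v" "mpoly_value f v = 0" for w
    using that by (auto simp: proj_point_def *)
  with proj_point_self[of v] show ?thesis by blast
qed

lemma istopology_zariski:
  "istopology (\<lambda>U. U \<subseteq> proj_space \<and> zariski_closed (proj_space - U :: ('k::field ^ 'n::finite) set set))"
  unfolding istopology_def
proof (intro conjI allI impI; (elim conjE)?)
  fix U V :: "('k ^ 'n) set set"
  assume "U \<subseteq> proj_space" then show "U \<inter> V \<subseteq> proj_space" by auto
next
  fix U V :: "('k ^ 'n) set set"
  assume "zariski_closed (proj_space - U)" "zariski_closed (proj_space - V)"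
  then obtain S T where S: "\<forall>f\<in>S. homogeneous f" "proj_space - U = zero_locus S"
    and T: "\<forall>f\<in>T. homogeneous f" "proj_space - V = zero_locus T"
    by (auto simp: zariski_closed_def)
  let ?R = "{f * g | f g. f \<in> S \<and> g \<in> T}"
  have hom: "\<forall>f\<in>?R. homogeneous f"
    using S(1) T(1) by (auto intro: homogeneous_mult)
  have eq: "p \<in> zero_locus ?R \<longleftrightarrow> p \<in> zero_locus S \<union> zero_locus T" if p: "p \<in> proj_space" for p
  proof -
    obtain v where v: "p = proj_point v" using p by (auto simp: proj_space_def)
    have vanish: "(p \<in> zero_locus Q) \<longleftrightarrow> (\<forall>f\<in>Q. mpoly_value f v = 0)"
      if "\<forall>f\<in>Q. homogeneous f" for Q
      using p that proj_point_vanish_iff[of _ v] by (auto simp: zero_locus_def v)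
    have "(\<forall>h\<in>?R. mpoly_value h v = 0) \<longleftrightarrow>
        (\<forall>f\<in>S. mpoly_value f v = 0) \<or> (\<forall>g\<in>T. mpoly_value g v = 0)"
      by (auto simp: mpoly_value_mult) (metis mpoly_value_mult mult_eq_0_iff)
    then show ?thesis
      using vanish[OF hom] vanish[OF S(1)] vanish[OF T(1)] by blast
  qed
  have sub: "p \<in> proj_space" if "p \<in> zero_locus Q" for p and Q :: "('n, 'k) mpoly set"
    using that by (simp add: zero_locus_def)
  have "zero_locus ?R = zero_locus S \<union> zero_locus T"
  proof (intro Set.set_eqI)
    fix p
    show "p \<in> zero_locus ?R \<longleftrightarrow> p \<in> zero_locus S \<union> zero_locus T"
    proof (cases "p \<in> proj_space")
      case True
      then show ?thesis by (rule eq)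
    next
      case False
      then show ?thesis using sub[of p ?R] sub[of p S] sub[of p T] by blast
    qed
  qed
  moreover have "proj_space - (U \<inter> V) = zero_locus S \<union> zero_locus T"
    using S(2) T(2) by blast
  ultimately show "zariski_closed (proj_space - U \<inter> V)"
    using hom unfolding zariski_closed_def by (intro exI[of _ ?R] conjI) simp_all
next
  fix \<U> :: "('k ^ 'n) set set set"
  assume "\<forall>U\<in>\<U>. U \<subseteq> proj_space \<and> zariski_closed (proj_space - U)"
  then show "\<Union>\<U> \<subseteq> proj_space" by auto
next
  fix \<U> :: "('k ^ 'n) set set set"
  assume "\<forall>U\<in>\<U>. U \<subseteq> proj_space \<and> zariski_closed (proj_space - U)"
  then obtain S where S: "\<And>U. U \<in> \<U> \<Longrightarrow> (\<forall>f\<in>S U. homogeneous f) \<and> proj_space - U = zero_locus (S U)"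
    unfolding zariski_closed_def by metis
  have "proj_space - \<Union>\<U> = zero_locus (\<Union>U\<in>\<U>. S U)"
  proof (intro Set.set_eqI)
    fix p
    have "p \<in> proj_space - \<Union>\<U> \<longleftrightarrow> p \<in> proj_space \<and> (\<forall>U\<in>\<U>. p \<in> proj_space - U)" by auto
    also have "\<dots> \<longleftrightarrow> p \<in> zero_locus (\<Union>U\<in>\<U>. S U)"
    proof -
      have "p \<in> proj_space - U \<longleftrightarrow> p \<in> proj_space \<and> (\<forall>f\<in>S U. \<forall>v\<in>p. mpoly_value f v = 0)"
        if "U \<in> \<U>" for U
        using S[OF that] by (simp add: zero_locus_def)
      then show ?thesis unfolding zero_locus_def mem_Collect_eq by blast
    qed
    finally show "p \<in> proj_space - \<Union>\<U> \<longleftrightarrow> p \<in> zero_locus (\<Union>U\<in>\<U>. S U)" .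
  qed
  moreover have "\<forall>f\<in>(\<Union>U\<in>\<U>. S U). homogeneous f"
    using S by blast
  ultimately show "zariski_closed (proj_space - \<Union>\<U>)"
    unfolding zariski_closed_def by (intro exI[of _ "\<Union>U\<in>\<U>. S U"] conjI)
qed

lemma openin_zariski:
  "openin zariski_topology U \<longleftrightarrow> U \<subseteq> proj_space \<and> zariski_closed (proj_space - U)"
  by (simp add: zariski_topology_def topology_inverse'[OF istopology_zariski])

lemma topspace_zariski [simp]: "topspace zariski_topology = (proj_space :: ('k::field ^ 'n::finite) set set)"
proof -
  have "p \<notin> zero_locus {1}" for p :: "('k ^ 'n) set"
  proof
    assume "p \<in> zero_locus {1}"
    then obtain v :: "'k ^ 'n" where "p = proj_point v" "\<forall>w\<in>p. mpoly_value 1 w = 0"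
      by (auto simp: zero_locus_def proj_space_def)
    with proj_point_self[of v] show False by simp
  qed
  then have "zero_locus {1} = ({} :: ('k ^ 'n) set set)" by blast
  then have "zariski_closed ({} :: ('k ^ 'n) set set)"
    unfolding zariski_closed_def by (intro exI[of _ "{1}"]) (simp add: homogeneous_1)
  then have "openin zariski_topology (proj_space :: ('k ^ 'n) set set)"
    by (simp add: openin_zariski)
  then show ?thesis
    by (metis openin_subset openin_topspace openin_zariski subset_antisym)
qed

lemma closedin_zariski: "closedin zariski_topology Z \<longleftrightarrow> zariski_closed Z"
proof -
  have "Z \<subseteq> proj_space" if "zariski_closed Z"
    using that by (auto simp: zariski_closed_def zero_locus_def)
  then show ?thesis
    by (auto simp: closedin_def openin_zariski double_diff)
qed

text \<open>
  The points of a set of projective points over an extension of the rationals that admit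
  rational homogeneous coordinates.
\<close>

definition rational_points :: "('k::field_char_0 ^ 'n) set set \<Rightarrow> ('k ^ 'n) set set" where
  "rational_points Z = {p \<in> Z. \<exists>v\<in>p. \<forall>i. v $ i \<in> \<rat>}"

text \<open>
  Homogeneous coordinates \<open>[x:y:z:a:b:c]\<close> are the components \<open>1, \<dots>, 6\<close>
  of a vector (in the index type \<open>6\<close>, the elements \<open>6\<close> and \<open>0\<close> coincide).  As the variety
  is defined over the rationals, it is represented by its points over the algebraic closure of
  the rationals, which is where the Zariski topology is taken.
\<close>

definition surface_equations :: "'k::field ^ 6 \<Rightarrow> bool" where
  "surface_equations v \<longleftrightarrow>
    (let x = v $ 1; y = v $ 2; z = v $ 3; a = v $ 4; b = v $ 5; c = v $ 6 in
      x + y + z = 0 \<and>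
      x * y + y * z + z * x = - a\<^sup>2 - b\<^sup>2 - c\<^sup>2 \<and>
      x * y * z = 2 * a * b * c)"

definition surface :: "(rat alg_closure ^ 6) set set" where
  "surface = {proj_point v | v. v \<noteq> 0 \<and> surface_equations v}"

end

theory Submission
  imports Defs
begin

text \<open>
  Normalize \<open>a = 1\<close> and put \<open>p = b + c\<close>, \<open>q = b - c\<close>.  The surface becomes
  \<open>p\<^sup>2 = (x - 1) (y - 1) (z - 1)\<close>, \<open>q\<^sup>2 = - (x + 1) (y + 1) (z + 1)\<close> with \<open>z = - x - y\<close>,
  a cover of the \<open>(x, y)\<close>-plane with group generated by the sign changes of \<open>p\<close> and \<open>q\<close>.
  A polynomial on it is \<open>A + B p + C q + D p q\<close> with \<open>A, B, C, D\<close> polynomials in \<open>x, y\<close>.  As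
  the rational points are stable under the sign changes, it suffices that those with \<open>p q \<noteq> 0\<close>
  have Zariski dense image in the plane, that is, that infinitely many lines \<open>x = t\<close> contain
  infinitely many image points.  Points with \<open>a = 0\<close> are reached by permuting \<open>a, b, c\<close>, which
  cannot all vanish.

  If \<open>1 - t\<close> and \<open>1 + t\<close> are squares, the fibre over \<open>x = t\<close> is the curve
  \<open>P\<^sup>2 = Y\<^sup>2 - (2 + t)\<^sup>2\<close>, \<open>Q\<^sup>2 = Y\<^sup>2 - (2 - t)\<^sup>2\<close> with \<open>Y = 2 y + t\<close>, which maps to the
  elliptic curve \<open>N\<^sup>2 = V (V - (2 + t)\<^sup>2) (V - (2 - t)\<^sup>2)\<close> by \<open>V = Y\<^sup>2\<close>, \<open>N = Y P Q\<close>; its rational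
  points lie over the doubles of rational points.  Doubling lowers the 2-adic valuation of \<open>Y\<close>
  by one once it is negative, as in the theorem of Nagell and Lutz, so repeated doubling of the
  rational point with \<open>V = t\<^sup>2\<close> gives infinitely many points for suitable \<open>t\<close>.
\<close>

section \<open>Two-adic valuations of rational numbers\<close>

text \<open>A relation rather than a valuation function: zero satisfies it for no \<open>k\<close>,
  so every valuation statement also certifies nonvanishing.\<close>

definition two_adic :: "int \<Rightarrow> rat \<Rightarrow> bool" where
  "two_adic k r \<longleftrightarrow> (\<exists>a b. odd a \<and> odd b \<and> r = 2 powi k * (of_int a / of_int b))"

lemma two_adic_nonzero: "two_adic k r \<Longrightarrow> r \<noteq> 0"
  by (auto simp: two_adic_def)

lemma two_adic_of_odd: "odd a \<Longrightarrow> two_adic 0 (of_int a)"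
  unfolding two_adic_def by (intro exI[of _ a] exI[of _ 1]) auto

lemma two_adic_power2: "two_adic k (2 powi k)"
  unfolding two_adic_def by (intro exI[of _ 1]) auto

lemma two_adic_two: "two_adic 1 2"
  using two_adic_power2[of 1] by simp

lemma two_adic_uminus: "two_adic k r \<Longrightarrow> two_adic k (- r)"
  unfolding two_adic_def
proof (elim exE conjE)
  fix a b assume "odd a" "odd b" "r = 2 powi k * (of_int a / of_int b)"
  then show "\<exists>a b. odd a \<and> odd b \<and> - r = 2 powi k * (of_int a / of_int b)"
    by (intro exI[of _ "- a"] exI[of _ b]) auto
qed

lemma two_adic_mult:
  assumes "two_adic k r" "two_adic l s"
  shows "two_adic (k + l) (r * s)"
proof -
  obtain a b c d where "odd a" "odd b" "r = 2 powi k * (of_int a / of_int b)"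
    "odd c" "odd d" "s = 2 powi l * (of_int c / of_int d)"
    using assms by (auto simp: two_adic_def)
  then show ?thesis
    unfolding two_adic_def
    by (intro exI[of _ "a * c"] exI[of _ "b * d"]) (auto simp: power_int_add)
qed

lemma two_adic_divide:
  assumes "two_adic k r" "two_adic l s"
  shows "two_adic (k - l) (r / s)"
proof -
  obtain a b c d where odd: "odd a" "odd b" "odd c" "odd d"
    and r: "r = 2 powi k * (of_int a / of_int b)" and s: "s = 2 powi l * (of_int c / of_int d)"
    using assms by (auto simp: two_adic_def)
  have "r / s = 2 powi (k - l) * (of_int (a * d) / of_int (b * c))"
    by (simp add: r s power_int_diff ac_simps)
  with odd show ?thesis
    unfolding two_adic_def by (intro exI[of _ "a * d"] exI[of _ "b * c"]) simp
qed

lemma two_adic_power: "two_adic k r \<Longrightarrow> two_adic (int n * k) (r ^ n)"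
proof (induction n)
  case 0
  show ?case using two_adic_of_odd[of 1] by simp
next
  case (Suc n)
  then show ?case using two_adic_mult[of k r "int n * k" "r ^ n"] by (simp add: algebra_simps)
qed

text \<open>Over the common denominator the summand of smaller valuation contributes an odd integer
  to the numerator, the other an even one.\<close>

lemma two_adic_add:
  assumes "two_adic k r" "two_adic l s" "k < l"
  shows "two_adic k (r + s)"
proof -
  obtain a b c d where *: "odd a" "odd b" "r = 2 powi k * (of_int a / of_int b)"
    "odd c" "odd d" "s = 2 powi l * (of_int c / of_int d)"
    using assms by (auto simp: two_adic_def)
  have "b \<noteq> 0" "d \<noteq> 0" using * by auto
  define n where "n = nat (l - k)"
  have n: "l = k + int n" "n > 0" using assms(3) by (auto simp: n_def)
  have "(2::rat) powi l = 2 powi k * 2 ^ n"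
    by (simp add: n(1) power_int_add)
  then have "r + s = 2 powi k * (of_int (a * d + 2 ^ n * c * b) / of_int (b * d))"
    using * by (simp add: field_simps \<open>b \<noteq> 0\<close> \<open>d \<noteq> 0\<close>)
  moreover have "odd (a * d + 2 ^ n * c * b)" "odd (b * d)" using * n(2) by auto
  ultimately show ?thesis unfolding two_adic_def by blast
qed

lemma two_adic_diff:
  assumes "two_adic k r" "two_adic l s" "k < l"
  shows "two_adic k (r - s)"
  using two_adic_add[OF assms(1) two_adic_uminus[OF assms(2)] assms(3)] by simp

lemma two_adic_unique:
  assumes "two_adic k r" "two_adic l r"
  shows "k = l"
proof -
  have less: False if "two_adic k r" "two_adic l r" "k < l" for k l
    using two_adic_nonzero[OF two_adic_diff[OF that]] by simp
  show ?thesis using less[of k l] less[of l k] assms by (meson linorder_neqE)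
qed

section \<open>Rational points on the fibres\<close>

lemma square_quotient:
  fixes a b c n :: "'a::field"
  assumes "a\<^sup>2 = b\<^sup>2 - c\<^sup>2 * n\<^sup>2" "n \<noteq> 0"
  shows "(a / n)\<^sup>2 = (b / n)\<^sup>2 - c\<^sup>2"
  using assms by (simp add: power_divide field_simps)

text \<open>On the elliptic curve with roots \<open>0\<close>, \<open>\<alpha>\<^sup>2\<close>,
  \<open>\<beta>\<^sup>2\<close> the abscissa of a double differs from each root by a square. The
  duplication formulas name the square roots and so lift doubling to triples
  \<open>(Y, P, Q)\<close>.\<close>

lemma doubling_step:
  fixes Y P Q \<alpha> \<beta> :: rat
  assumes "k > 0" "two_adic 1 \<alpha>" "two_adic 1 \<beta>"
    and "two_adic (- k) Y" "two_adic (- k) P" "two_adic (- k) Q"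
    and P: "P\<^sup>2 = Y\<^sup>2 - \<alpha>\<^sup>2" and Q: "Q\<^sup>2 = Y\<^sup>2 - \<beta>\<^sup>2"
  shows "\<exists>Y P Q. two_adic (- (k + 1)) Y \<and> two_adic (- (k + 1)) P \<and> two_adic (- (k + 1)) Q \<and>
    P\<^sup>2 = Y\<^sup>2 - \<alpha>\<^sup>2 \<and> Q\<^sup>2 = Y\<^sup>2 - \<beta>\<^sup>2"
proof -
  \<comment> \<open>Doubling of the point with abscissa \<open>Y\<^sup>2\<close> and ordinate
    \<open>Y * P * Q\<close>; the denominator \<open>N\<close> is twice the ordinate.\<close>
  define N where "N = 2 * (Y * (P * Q))"
  define Y' where "Y' = (Y ^ 4 - \<alpha>\<^sup>2 * \<beta>\<^sup>2) / N"
  define P' where "P' = (Y ^ 4 - 2 * (\<alpha>\<^sup>2 * Y\<^sup>2) + \<alpha>\<^sup>2 * \<beta>\<^sup>2) / N"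
  define Q' where "Q' = (Y ^ 4 - 2 * (\<beta>\<^sup>2 * Y\<^sup>2) + \<alpha>\<^sup>2 * \<beta>\<^sup>2) / N"
  have N: "two_adic (1 - 3 * k) N"
    using two_adic_mult[OF two_adic_two two_adic_mult[OF assms(4) two_adic_mult[OF assms(5,6)]]]
    by (simp add: N_def)
  have Y4: "two_adic (- 4 * k) (Y ^ 4)"
    using two_adic_power[OF assms(4), of 4] by simp
  have sq: "two_adic (- 2 * k) (Y\<^sup>2)" "two_adic 2 (\<alpha>\<^sup>2)" "two_adic 2 (\<beta>\<^sup>2)"
    using two_adic_power[OF assms(4), of 2] two_adic_power[OF assms(2), of 2]
      two_adic_power[OF assms(3), of 2] by simp_all
  have ab: "two_adic 4 (\<alpha>\<^sup>2 * \<beta>\<^sup>2)"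
    using two_adic_mult[OF sq(2,3)] by simp
  have aY: "two_adic (3 - 2 * k) (2 * (\<alpha>\<^sup>2 * Y\<^sup>2))"
    using two_adic_mult[OF two_adic_two two_adic_mult[OF sq(2,1)]] by simp
  have bY: "two_adic (3 - 2 * k) (2 * (\<beta>\<^sup>2 * Y\<^sup>2))"
    using two_adic_mult[OF two_adic_two two_adic_mult[OF sq(3,1)]] by simp
  \<comment> \<open>Each numerator has the valuation of its dominant term \<open>Y ^ 4\<close>. The
    factor 2 in \<open>N\<close> is what lowers the quotients by one.\<close>
  have k: "- 4 * k - (1 - 3 * k) = - (k + 1)" by simp
  have "two_adic (- (k + 1)) Y'"
    unfolding Y'_def k[symmetric] using \<open>k > 0\<close>
    by (intro two_adic_divide[OF _ N] two_adic_diff[OF Y4 ab]) simp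
  moreover have "two_adic (- (k + 1)) P'"
    unfolding P'_def k[symmetric] using \<open>k > 0\<close>
    by (intro two_adic_divide[OF _ N] two_adic_add[OF two_adic_diff[OF Y4 aY] ab]) simp_all
  moreover have "two_adic (- (k + 1)) Q'"
    unfolding Q'_def k[symmetric] using \<open>k > 0\<close>
    by (intro two_adic_divide[OF _ N] two_adic_add[OF two_adic_diff[OF Y4 bY] ab]) simp_all
  moreover have N2: "N\<^sup>2 = 4 * Y\<^sup>2 * (Y\<^sup>2 - \<alpha>\<^sup>2) * (Y\<^sup>2 - \<beta>\<^sup>2)"
    unfolding N_def power_mult_distrib P Q by simp
  have N0: "N \<noteq> 0" using N by (rule two_adic_nonzero)
  have "P'\<^sup>2 = Y'\<^sup>2 - \<alpha>\<^sup>2"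
  proof -
    have "(Y ^ 4 - 2 * (\<alpha>\<^sup>2 * Y\<^sup>2) + \<alpha>\<^sup>2 * \<beta>\<^sup>2)\<^sup>2 = (Y ^ 4 - \<alpha>\<^sup>2 * \<beta>\<^sup>2)\<^sup>2 - \<alpha>\<^sup>2 * N\<^sup>2"
      unfolding N2 by Groebner_Basis.algebra
    then show ?thesis
      unfolding P'_def Y'_def using N0 by (rule square_quotient)
  qed
  moreover have "Q'\<^sup>2 = Y'\<^sup>2 - \<beta>\<^sup>2"
  proof -
    have "(Y ^ 4 - 2 * (\<beta>\<^sup>2 * Y\<^sup>2) + \<alpha>\<^sup>2 * \<beta>\<^sup>2)\<^sup>2 = (Y ^ 4 - \<alpha>\<^sup>2 * \<beta>\<^sup>2)\<^sup>2 - \<beta>\<^sup>2 * N\<^sup>2"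
      unfolding N2 by Groebner_Basis.algebra
    then show ?thesis
      unfolding Q'_def Y'_def using N0 by (rule square_quotient)
  qed
  ultimately show ?thesis by blast
qed

text \<open>The iterated doubles have pairwise different 2-adic valuations, hence are
  distinct.\<close>

lemma infinite_doubling_orbit:
  fixes Y P Q \<alpha> \<beta> :: rat
  assumes "k > 0" "two_adic 1 \<alpha>" "two_adic 1 \<beta>"
    and "two_adic (- k) Y" "two_adic (- k) P" "two_adic (- k) Q"
    and "P\<^sup>2 = Y\<^sup>2 - \<alpha>\<^sup>2" "Q\<^sup>2 = Y\<^sup>2 - \<beta>\<^sup>2"
  shows "infinite {Y. \<exists>P Q. P \<noteq> 0 \<and> Q \<noteq> 0 \<and> P\<^sup>2 = Y\<^sup>2 - \<alpha>\<^sup>2 \<and> Q\<^sup>2 = Y\<^sup>2 - \<beta>\<^sup>2}"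
    (is "infinite ?A")
proof -
  have "\<exists>Y P Q. two_adic (- (k + int n)) Y \<and> two_adic (- (k + int n)) P \<and>
      two_adic (- (k + int n)) Q \<and> P\<^sup>2 = Y\<^sup>2 - \<alpha>\<^sup>2 \<and> Q\<^sup>2 = Y\<^sup>2 - \<beta>\<^sup>2" for n
  proof (induction n)
    case 0
    show ?case using assms(4-) by auto
  next
    case (Suc n)
    then obtain Y P Q where "two_adic (- (k + int n)) Y" "two_adic (- (k + int n)) P"
      "two_adic (- (k + int n)) Q" "P\<^sup>2 = Y\<^sup>2 - \<alpha>\<^sup>2" "Q\<^sup>2 = Y\<^sup>2 - \<beta>\<^sup>2"
      by blast
    from doubling_step[OF _ assms(2,3) this] \<open>k > 0\<close>
    show ?case by (simp add: algebra_simps)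
  qed
  then obtain S where S: "\<And>n. two_adic (- (k + int n)) (S n)" "\<And>n. S n \<in> ?A"
    by (simp only: mem_Collect_eq) (metis two_adic_nonzero)
  have "inj S"
  proof (rule injI)
    fix m n assume "S m = S n"
    then have "- (k + int m) = - (k + int n)"
      using S(1)[of m] S(1)[of n] two_adic_unique by simp
    then show "m = n" by simp
  qed
  then have "infinite (range S)" by (rule range_inj_infinite)
  moreover have "range S \<subseteq> ?A" using S(2) by blast
  ultimately show ?thesis using finite_subset by blast
qed

text \<open>Points with \<open>p = 0\<close> or \<open>q = 0\<close> are excluded so that changing
  the signs of \<open>p\<close> and \<open>q\<close> later separates four coefficients.\<close>

definition fibre_points :: "rat \<Rightarrow> rat set" where
  "fibre_points x = {y. \<exists>p q. p \<noteq> 0 \<and> q \<noteq> 0 \<and> p\<^sup>2 = (x - 1) * (y - 1) * (- x - y - 1) \<and>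
    q\<^sup>2 = - (x + 1) * (y + 1) * (1 - x - y)}"

text \<open>
  The initial value \<open>Y = (2 - t\<^sup>2) / (t \<mu> \<nu>)\<close> comes from doubling the point with \<open>V = t\<^sup>2\<close>,
  \<open>N = 4 t \<mu> \<nu>\<close>.
\<close>

lemma infinite_fibre_points:
  fixes \<mu> \<nu> t :: rat
  assumes mu: "\<mu>\<^sup>2 = 1 - t" and nu: "\<nu>\<^sup>2 = 1 + t"
    and units: "two_adic 0 \<mu>" "two_adic 0 \<nu>" and t: "two_adic j t" and j: "j > 1"
  shows "infinite (fibre_points t)"
proof -
  define s where "s = \<mu> * \<nu>"
  have s: "two_adic 0 s" using two_adic_mult[OF units] by (simp add: s_def)
  have s2: "s\<^sup>2 = 1 - t\<^sup>2"
    unfolding s_def power_mult_distrib mu nu by (simp add: algebra_simps power2_eq_square)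
  have ts: "two_adic j (t * s)" using two_adic_mult[OF t s] by simp
  have t2: "two_adic (2 * j) (t\<^sup>2)" and t3: "two_adic (3 * j) (t ^ 3)"
    using two_adic_power[OF t, of 2] two_adic_power[OF t, of 3] by simp_all
  have tt: "two_adic (2 * j + 1) (2 * t\<^sup>2)"
    using two_adic_mult[OF two_adic_two t2] by (simp add: add.commute)
  have \<alpha>: "two_adic 1 (2 + t)" and \<beta>: "two_adic 1 (2 - t)"
    using two_adic_add[OF two_adic_two t] two_adic_diff[OF two_adic_two t] j by simp_all
  \<comment> \<open>Since \<open>j > 1\<close>, the starting point has negative valuation, as the
    doubling argument requires.\<close>
  have k: "1 - j = - (j - 1)" by simp
  have Y: "two_adic (- (j - 1)) ((2 - t\<^sup>2) / (t * s))"
    unfolding k[symmetric] using j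
    by (intro two_adic_divide[OF _ ts] two_adic_diff[OF two_adic_two t2]) simp
  have P: "two_adic (- (j - 1)) ((2 - 2 * t\<^sup>2 - t ^ 3) / (t * s))"
    unfolding k[symmetric] using j
    by (intro two_adic_divide[OF _ ts] two_adic_diff[OF two_adic_diff[OF two_adic_two tt] t3]) simp_all
  have Q: "two_adic (- (j - 1)) ((2 - 2 * t\<^sup>2 + t ^ 3) / (t * s))"
    unfolding k[symmetric] using j
    by (intro two_adic_divide[OF _ ts] two_adic_add[OF two_adic_diff[OF two_adic_two tt] t3]) simp_all
  have ts0: "t * s \<noteq> 0" using ts by (rule two_adic_nonzero)
  have "(2 - 2 * t\<^sup>2 - t ^ 3)\<^sup>2 = (2 - t\<^sup>2)\<^sup>2 - (2 + t)\<^sup>2 * (t * s)\<^sup>2"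
    unfolding power_mult_distrib s2 by Groebner_Basis.algebra
  then have eqP: "((2 - 2 * t\<^sup>2 - t ^ 3) / (t * s))\<^sup>2 = ((2 - t\<^sup>2) / (t * s))\<^sup>2 - (2 + t)\<^sup>2"
    using ts0 by (rule square_quotient)
  have "(2 - 2 * t\<^sup>2 + t ^ 3)\<^sup>2 = (2 - t\<^sup>2)\<^sup>2 - (2 - t)\<^sup>2 * (t * s)\<^sup>2"
    unfolding power_mult_distrib s2 by Groebner_Basis.algebra
  then have eqQ: "((2 - 2 * t\<^sup>2 + t ^ 3) / (t * s))\<^sup>2 = ((2 - t\<^sup>2) / (t * s))\<^sup>2 - (2 - t)\<^sup>2"
    using ts0 by (rule square_quotient)
  let ?A = "{Y. \<exists>P Q. P \<noteq> 0 \<and> Q \<noteq> 0 \<and> P\<^sup>2 = Y\<^sup>2 - (2 + t)\<^sup>2 \<and> Q\<^sup>2 = Y\<^sup>2 - (2 - t)\<^sup>2}"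
  have "infinite ?A"
    using infinite_doubling_orbit[OF _ \<alpha> \<beta> Y P Q eqP eqQ] j by simp
  moreover have "inj_on (\<lambda>Y. (Y - t) / 2) ?A" by (rule inj_onI) simp
  ultimately have inf: "infinite ((\<lambda>Y. (Y - t) / 2) ` ?A)" using finite_imageD by blast
  have "(Y - t) / 2 \<in> fibre_points t" if Y: "Y \<in> ?A" for Y
  proof -
    obtain P Q where nz: "P \<noteq> 0" "Q \<noteq> 0" and PQ: "P\<^sup>2 = Y\<^sup>2 - (2 + t)\<^sup>2" "Q\<^sup>2 = Y\<^sup>2 - (2 - t)\<^sup>2"
      using Y by blast
    \<comment> \<open>With \<open>y = (Y - t) / 2\<close> the right-hand sides become
      \<open>(1 - t) * P\<^sup>2 / 4\<close> and \<open>(1 + t) * Q\<^sup>2 / 4\<close>;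
      \<open>\<mu>\<close> and \<open>\<nu>\<close> absorb the square factors.\<close>
    have "\<mu> * P / 2 \<noteq> 0" "\<nu> * Q / 2 \<noteq> 0"
      using nz units two_adic_nonzero by auto
    moreover have "(\<mu> * P / 2)\<^sup>2 = (t - 1) * ((Y - t) / 2 - 1) * (- t - (Y - t) / 2 - 1)"
      unfolding power_divide power_mult_distrib mu PQ by (simp add: field_simps power2_eq_square)
    moreover have "(\<nu> * Q / 2)\<^sup>2 = - (t + 1) * ((Y - t) / 2 + 1) * (1 - t - (Y - t) / 2)"
      unfolding power_divide power_mult_distrib nu PQ by (simp add: field_simps power2_eq_square)
    ultimately show ?thesis unfolding fibre_points_def by blast
  qed
  then have "(\<lambda>Y. (Y - t) / 2) ` ?A \<subseteq> fibre_points t" by blast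
  with inf show ?thesis using finite_subset by blast
qed

text \<open>Parametrizing the conic of pairs \<open>(\<mu>, \<nu>)\<close> makes
  \<open>1 - t\<close> and \<open>1 + t\<close> squares; parameters divisible by growing powers of 2
  give values \<open>t\<close> told apart by their valuations.\<close>

lemma infinite_good_fibres: "infinite {t. infinite (fibre_points t)}"
proof -
  have ex: "\<exists>t. two_adic (int n + 3) t \<and> infinite (fibre_points t)" for n
  proof -
    \<comment> \<open>An even parameter keeps \<open>C\<close> and the numerators of
      \<open>\<mu>\<close> and \<open>\<nu>\<close> odd. The factor 4 in \<open>t\<close> adds two
      to the exponent \<open>n + 1\<close>.\<close>
    define R :: int where "R = 2 ^ (n + 1)"
    define C where "C = R\<^sup>2 + 1"
    define r c where "r = rat_of_int R" and "c = rat_of_int C"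
    have even: "even R" by (simp add: R_def)
    have c: "c = r\<^sup>2 + 1" by (simp add: c_def C_def r_def)
    have oddC: "odd C" using even by (simp add: C_def)
    have two_c: "two_adic 0 c" unfolding c_def using oddC by (rule two_adic_of_odd)
    then have c0: "c \<noteq> 0" by (rule two_adic_nonzero)
    have two_r: "two_adic (int n + 1) r"
      using two_adic_power[OF two_adic_two, of "n + 1"] by (simp add: r_def R_def add.commute)
    \<comment> \<open>the rational parametrization of \<open>\<mu>\<^sup>2 + \<nu>\<^sup>2 = 2\<close>\<close>
    define t where "t = 4 * r * (1 - r\<^sup>2) / c\<^sup>2"
    define \<mu> where "\<mu> = (r\<^sup>2 + 2 * r - 1) / c"
    define \<nu> where "\<nu> = (r\<^sup>2 - 2 * r - 1) / c"
    have "two_adic 0 (rat_of_int (R\<^sup>2 + 2 * R - 1))" "two_adic 0 (rat_of_int (R\<^sup>2 - 2 * R - 1))"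
      "two_adic 0 (rat_of_int (1 - R\<^sup>2))"
      using even by (intro two_adic_of_odd; simp)+
    then have odds: "two_adic 0 (r\<^sup>2 + 2 * r - 1)" "two_adic 0 (r\<^sup>2 - 2 * r - 1)" "two_adic 0 (1 - r\<^sup>2)"
      by (simp_all add: r_def)
    have units: "two_adic 0 \<mu>" "two_adic 0 \<nu>"
      using two_adic_divide[OF odds(1) two_c] two_adic_divide[OF odds(2) two_c]
      by (simp_all add: \<mu>_def \<nu>_def)
    have four: "two_adic 2 4" using two_adic_power[OF two_adic_two, of 2] by simp
    have t: "two_adic (int n + 3) t"
      using two_adic_divide[OF two_adic_mult[OF two_adic_mult[OF four two_r] odds(3)]
        two_adic_power[OF two_c, of 2]] by (simp add: t_def add.commute)
    have "(r\<^sup>2 + 2 * r - 1)\<^sup>2 = c\<^sup>2 - 4 * r * (1 - r\<^sup>2)" "(r\<^sup>2 - 2 * r - 1)\<^sup>2 = c\<^sup>2 + 4 * r * (1 - r\<^sup>2)"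
      unfolding c by Groebner_Basis.algebra+
    then have "\<mu>\<^sup>2 = (c\<^sup>2 - 4 * r * (1 - r\<^sup>2)) / c\<^sup>2" "\<nu>\<^sup>2 = (c\<^sup>2 + 4 * r * (1 - r\<^sup>2)) / c\<^sup>2"
      by (simp_all only: \<mu>_def \<nu>_def power_divide)
    then have "\<mu>\<^sup>2 = 1 - t" "\<nu>\<^sup>2 = 1 + t"
      using c0 by (simp_all add: t_def add_divide_distrib diff_divide_distrib)
    from infinite_fibre_points[OF this units t] t show ?thesis by auto
  qed
  then obtain T where T: "\<And>n. two_adic (int n + 3) (T n)" "\<And>n. infinite (fibre_points (T n))"
    by metis
  have "inj T"
  proof (rule injI)
    fix m n assume "T m = T n"
    then have "int m + 3 = int n + 3"
      using two_adic_unique[OF T(1)[of m], of "int n + 3"] T(1)[of n] by simp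
    then show "m = n" by simp
  qed
  then have "infinite (range T)" by (rule range_inj_infinite)
  moreover have "range T \<subseteq> {t. infinite (fibre_points t)}" using T(2) by blast
  ultimately show ?thesis using finite_subset by blast
qed

section \<open>Polynomial functions on the surface\<close>

text \<open>The outer variable is \<open>y\<close>, the inner one \<open>x\<close>. On each line
  \<open>x = t\<close> the polynomial in \<open>y\<close> has infinitely many roots, so every
  coefficient vanishes at infinitely many \<open>t\<close>.\<close>

lemma bivariate_poly_eq_0:
  fixes A :: "'k::field_char_0 poly poly"
  assumes inf: "infinite T" "\<And>t. t \<in> T \<Longrightarrow> infinite (S t)"
    and zero: "\<And>t y. t \<in> T \<Longrightarrow> y \<in> S t \<Longrightarrow> poly (poly A [:of_rat y:]) (of_rat t) = 0"
  shows "A = 0"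
proof -
  have infinite_of_rat: "infinite (of_rat ` B :: 'k set)" if "infinite B" for B
    using that finite_imageD[of of_rat B] by (auto simp: inj_on_def)
  \<comment> \<open>Specializing \<open>x\<close> before \<open>y\<close> gives the same value and
    leaves a univariate polynomial in \<open>y\<close>.\<close>
  have eval: "poly (map_poly (\<lambda>c. poly c t) B) y = poly (poly B [:y:]) t" for B :: "'k poly poly" and t y
    by (induction B) (simp_all add: map_poly_pCons)
  have "poly (coeff A i) (of_rat t) = 0" if "t \<in> T" for t i
  proof -
    have "of_rat ` S t \<subseteq> {y. poly (map_poly (\<lambda>c. poly c (of_rat t)) A) y = 0}"
      using zero[OF that] by (auto simp: eval)
    then have "map_poly (\<lambda>c. poly c (of_rat t)) A = 0"
      using infinite_of_rat[OF inf(2)[OF that]] poly_roots_finite finite_subset by blast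
    then have "coeff (map_poly (\<lambda>c. poly c (of_rat t)) A) i = 0" by simp
    then show ?thesis by (simp add: coeff_map_poly)
  qed
  then have "of_rat ` T \<subseteq> {t. poly (coeff A i) t = 0}" for i by auto
  then have "coeff A i = 0" for i
    using infinite_of_rat[OF inf(1)] poly_roots_finite finite_subset by metis
  then show ?thesis by (simp add: poly_eq_iff)
qed

definition chart_equations :: "'k::field \<Rightarrow> 'k \<Rightarrow> 'k \<Rightarrow> 'k \<Rightarrow> bool" where
  "chart_equations x y p q \<longleftrightarrow>
    p\<^sup>2 = (x - 1) * (y - 1) * (- x - y - 1) \<and> q\<^sup>2 = - (x + 1) * (y + 1) * (1 - x - y)"

text \<open>Functions that agree on the affine surface with an element of the module spanned by
  \<open>1\<close>, \<open>p\<close>, \<open>q\<close>, \<open>p * q\<close> over the polynomials in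
  \<open>x\<close> and \<open>y\<close>.\<close>

definition normalizable :: "('k::field \<Rightarrow> 'k \<Rightarrow> 'k \<Rightarrow> 'k \<Rightarrow> 'k) \<Rightarrow> bool" where
  "normalizable F \<longleftrightarrow> (\<exists>A B C D. \<forall>x y p q. chart_equations x y p q \<longrightarrow>
    F x y p q = poly (poly A [:y:]) x + poly (poly B [:y:]) x * p +
      poly (poly C [:y:]) x * q + poly (poly D [:y:]) x * (p * q))"

lemma normalizable_const: "normalizable (\<lambda>x y p q. k)"
  unfolding normalizable_def by (intro exI[of _ "[:[:k:]:]"] exI[of _ 0]) simp

lemma normalizable_coords:
  "normalizable (\<lambda>x y p q. x)" "normalizable (\<lambda>x y p q. y)"
  "normalizable (\<lambda>x y p q. p)" "normalizable (\<lambda>x y p q. q)"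
  unfolding normalizable_def
     apply (rule exI[of _ "[:[:0, 1:]:]"], (rule exI[of _ 0])+, simp)
    apply (rule exI[of _ "[:0, 1:]"], (rule exI[of _ 0])+, simp)
   apply (rule exI[of _ 0], rule exI[of _ 1], (rule exI[of _ 0])+, simp)
  apply (rule exI[of _ 0], rule exI[of _ 0], rule exI[of _ 1], rule exI[of _ 0], simp)
  done

lemma normalizable_add:
  assumes "normalizable F" "normalizable G"
  shows "normalizable (\<lambda>x y p q. F x y p q + G x y p q)"
proof -
  obtain A B C D A' B' C' D' where
    "\<And>x y p q. chart_equations x y p q \<Longrightarrow>
      F x y p q = poly (poly A [:y:]) x + poly (poly B [:y:]) x * p +
        poly (poly C [:y:]) x * q + poly (poly D [:y:]) x * (p * q)"
    "\<And>x y p q. chart_equations x y p q \<Longrightarrow>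
      G x y p q = poly (poly A' [:y:]) x + poly (poly B' [:y:]) x * p +
        poly (poly C' [:y:]) x * q + poly (poly D' [:y:]) x * (p * q)"
    using assms unfolding normalizable_def by metis
  then show ?thesis
    unfolding normalizable_def
    by (intro exI[of _ "A + A'"] exI[of _ "B + B'"] exI[of _ "C + C'"] exI[of _ "D + D'"])
       (simp add: algebra_simps)
qed

text \<open>The chart equations rewrite \<open>p\<^sup>2\<close> and \<open>q\<^sup>2\<close> as
  polynomials in \<open>x\<close> and \<open>y\<close>, so products of the four generators stay in
  the module.\<close>

lemma normalizable_mult:
  fixes F G :: "'k::field \<Rightarrow> 'k \<Rightarrow> 'k \<Rightarrow> 'k \<Rightarrow> 'k"
  assumes "normalizable F" "normalizable G"
  shows "normalizable (\<lambda>x y p q. F x y p q * G x y p q)"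
proof -
  obtain A B C D A' B' C' D' where FG:
    "\<And>x y p q. chart_equations x y p q \<Longrightarrow>
      F x y p q = poly (poly A [:y:]) x + poly (poly B [:y:]) x * p +
        poly (poly C [:y:]) x * q + poly (poly D [:y:]) x * (p * q)"
    "\<And>x y p q. chart_equations x y p q \<Longrightarrow>
      G x y p q = poly (poly A' [:y:]) x + poly (poly B' [:y:]) x * p +
        poly (poly C' [:y:]) x * q + poly (poly D' [:y:]) x * (p * q)"
    using assms unfolding normalizable_def by metis
  \<comment> \<open>The coordinates \<open>x\<close>, \<open>y\<close> and the constant 1 as
    bivariate polynomials, from which the right-hand sides of the chart equations are built.\<close>
  define S T U :: "'k poly poly" where "S = [:[:0, 1:]:]" and "T = [:0, 1:]" and "U = 1"
  define P Q where "P = (S - U) * (T - U) * (- S - T - U)" and "Q = - (S + U) * (T + U) * (U - S - T)"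
  have PQ: "p\<^sup>2 = poly (poly P [:y:]) x" "q\<^sup>2 = poly (poly Q [:y:]) x"
    if "chart_equations x y p q" for x y p q
    using that by (simp_all add: chart_equations_def P_def Q_def S_def T_def U_def)
  show ?thesis
    unfolding normalizable_def
  proof (intro exI allI impI)
    fix x y p q :: 'k
    assume eqs: "chart_equations x y p q"
    show "F x y p q * G x y p q =
        poly (poly (A * A' + B * B' * P + C * C' * Q + D * D' * P * Q) [:y:]) x +
        poly (poly (A * B' + B * A' + (C * D' + D * C') * Q) [:y:]) x * p +
        poly (poly (A * C' + C * A' + (B * D' + D * B') * P) [:y:]) x * q +
        poly (poly (A * D' + D * A' + B * C' + C * B') [:y:]) x * (p * q)"
      unfolding FG[OF eqs] poly_add poly_mult PQ[OF eqs, symmetric]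
      by (simp add: algebra_simps power2_eq_square)
  qed
qed

lemma normalizable_sum:
  assumes "\<And>i. i \<in> I \<Longrightarrow> normalizable (F i)"
  shows "normalizable (\<lambda>x y p q. \<Sum>i\<in>I. F i x y p q)"
  using assms
  by (induction I rule: infinite_finite_induct) (auto intro: normalizable_const normalizable_add)

lemma normalizable_prod:
  assumes "\<And>i. i \<in> I \<Longrightarrow> normalizable (F i)"
  shows "normalizable (\<lambda>x y p q. \<Prod>i\<in>I. F i x y p q)"
  using assms
  by (induction I rule: infinite_finite_induct) (auto intro: normalizable_const normalizable_mult)

lemma normalizable_power:
  "normalizable F \<Longrightarrow> normalizable (\<lambda>x y p q. F x y p q ^ n)"
  by (induction n) (auto intro: normalizable_const normalizable_mult)

lemma normalizable_mpoly_value: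
  fixes v :: "'k::field \<Rightarrow> 'k \<Rightarrow> 'k \<Rightarrow> 'k \<Rightarrow> 'k ^ 'n::finite"
  assumes "\<And>i. normalizable (\<lambda>x y p q. v x y p q $ i)"
  shows "normalizable (\<lambda>x y p q. mpoly_value f (v x y p q))"
  unfolding mpoly_value_def monom_value_def
  by (intro normalizable_sum normalizable_mult normalizable_const normalizable_prod
      normalizable_power assms)

text \<open>Sign changes of \<open>p\<close> and \<open>q\<close> preserve rational points, so
  \<open>A\<close>, \<open>B\<close>, \<open>C\<close>, \<open>D\<close> vanish separately at the
  image points of the good fibres, and hence identically.\<close>

lemma normalizable_vanish:
  fixes F :: "'k::field_char_0 \<Rightarrow> 'k \<Rightarrow> 'k \<Rightarrow> 'k \<Rightarrow> 'k"
  assumes "normalizable F"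
    and zero: "\<And>x y p q. \<lbrakk>x \<in> \<rat>; y \<in> \<rat>; p \<in> \<rat>; q \<in> \<rat>; chart_equations x y p q\<rbrakk> \<Longrightarrow> F x y p q = 0"
    and "chart_equations x y p q"
  shows "F x y p q = 0"
proof -
  obtain A B C D where F: "\<And>x y p q. chart_equations x y p q \<Longrightarrow>
      F x y p q = poly (poly A [:y:]) x + poly (poly B [:y:]) x * p +
        poly (poly C [:y:]) x * q + poly (poly D [:y:]) x * (p * q)"
    using assms(1) unfolding normalizable_def by metis
  have ABCD: "poly (poly A [:of_rat y:]) (of_rat x) = 0 \<and> poly (poly B [:of_rat y:]) (of_rat x) = 0 \<and>
      poly (poly C [:of_rat y:]) (of_rat x) = 0 \<and> poly (poly D [:of_rat y:]) (of_rat x) = 0"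
    if y: "y \<in> fibre_points x" for x y
  proof -
    obtain p q where pq: "p \<noteq> 0" "q \<noteq> 0" "p\<^sup>2 = (x - 1) * (y - 1) * (- x - y - 1)"
      "q\<^sup>2 = - (x + 1) * (y + 1) * (1 - x - y)"
      using y unfolding fibre_points_def by blast
    define x' y' p' q' :: 'k where "x' = of_rat x" and "y' = of_rat y" and "p' = of_rat p" and "q' = of_rat q"
    define a b c d where "a = poly (poly A [:y':]) x'" and "b = poly (poly B [:y':]) x'"
      and "c = poly (poly C [:y':]) x'" and "d = poly (poly D [:y':]) x'"
    have nz: "p' \<noteq> 0" "q' \<noteq> 0" using pq(1,2) by (simp_all add: p'_def q'_def)
    have "(of_rat (p\<^sup>2) :: 'k) = of_rat ((x - 1) * (y - 1) * (- x - y - 1))"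
      "(of_rat (q\<^sup>2) :: 'k) = of_rat (- (x + 1) * (y + 1) * (1 - x - y))"
      using pq(3,4) by simp_all
    then have eqs: "chart_equations x' y' p' q'"
      by (simp add: chart_equations_def x'_def y'_def p'_def q'_def
          of_rat_mult of_rat_add of_rat_diff of_rat_minus of_rat_power)
    then have signs: "chart_equations x' y' (- p') q'" "chart_equations x' y' p' (- q')"
      "chart_equations x' y' (- p') (- q')"
      by (simp_all add: chart_equations_def)
    have rat: "x' \<in> \<rat>" "y' \<in> \<rat>" "p' \<in> \<rat>" "q' \<in> \<rat>" "- p' \<in> \<rat>" "- q' \<in> \<rat>"
      by (simp_all add: x'_def y'_def p'_def q'_def)
    have z: "a + b * p' + c * q' + d * (p' * q') = 0" "a - b * p' + c * q' - d * (p' * q') = 0"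
      "a + b * p' - c * q' - d * (p' * q') = 0" "a - b * p' - c * q' + d * (p' * q') = 0"
      using zero[OF rat(1,2,3,4) eqs] zero[OF rat(1,2,5,4) signs(1)]
        zero[OF rat(1,2,3,6) signs(2)] zero[OF rat(1,2,5,6) signs(3)]
      unfolding F[OF eqs] F[OF signs(1)] F[OF signs(2)] F[OF signs(3)]
      by (simp_all add: a_def b_def c_def d_def)
    \<comment> \<open>Signed sums of the four equations isolate one term each; characteristic zero
      and \<open>p' * q' \<noteq> 0\<close> then allow cancellation.\<close>
    have "4 * a = 0" "4 * (b * p') = 0" "4 * (c * q') = 0" "4 * (d * (p' * q')) = 0"
      using z by Groebner_Basis.algebra+
    then show ?thesis
      using nz by (simp add: a_def b_def c_def d_def x'_def y'_def)
  qed
  have "A = 0" "B = 0" "C = 0" "D = 0"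
    by (rule bivariate_poly_eq_0[OF infinite_good_fibres, of fibre_points]; use ABCD in auto)+
  then show ?thesis using F[OF assms(3)] by simp
qed

section \<open>Density\<close>

lemma distinct_indices:
  "(1::6) \<noteq> 2" "(1::6) \<noteq> 3" "(1::6) \<noteq> 4" "(1::6) \<noteq> 5" "(1::6) \<noteq> 6"
  "(2::6) \<noteq> 3" "(2::6) \<noteq> 4" "(2::6) \<noteq> 5" "(2::6) \<noteq> 6" "(3::6) \<noteq> 4" "(3::6) \<noteq> 5" "(3::6) \<noteq> 6"
  "(4::6) \<noteq> 5" "(4::6) \<noteq> 6" "(5::6) \<noteq> 6"
  by simp_all

lemma index_cases: "i = 1 \<or> i = 2 \<or> i = 3 \<or> i = 4 \<or> i = 5 \<or> i = 6" for i :: 6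
proof -
  let ?S = "{1, 2, 3, 4, 5, 6} :: 6 set"
  have "card ?S = CARD(6)" using distinct_indices by simp
  then have "?S = UNIV" by (intro card_subset_eq) auto
  then show ?thesis by blast
qed

definition chart :: "'k::field \<Rightarrow> 'k \<Rightarrow> 'k \<Rightarrow> 'k \<Rightarrow> 'k ^ 6" where
  "chart x y p q = (\<chi> i. if i = 1 then x else if i = 2 then y else if i = 3 then - x - y
    else if i = 4 then 1 else if i = 5 then (p + q) / 2 else (p - q) / 2)"

lemma chart_nth:
  "chart x y p q $ 1 = x" "chart x y p q $ 2 = y" "chart x y p q $ 3 = - x - y"
  "chart x y p q $ 4 = 1" "chart x y p q $ 5 = (p + q) / 2" "chart x y p q $ 6 = (p - q) / 2"
  by (simp_all add: chart_def)

text \<open>Up to constant factors, the sum of the chart equations is the quadratic equation of the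
  surface and their difference the cubic one.\<close>

lemma surface_equations_chart:
  fixes x y p q :: "'k::field_char_0"
  assumes "chart_equations x y p q"
  shows "surface_equations (chart x y p q)"
proof -
  define b c where "b = (p + q) / 2" and "c = (p - q) / 2"
  have "p = b + c" "q = b - c" by (simp_all add: b_def c_def field_simps)
  then have "4 * (x * y + y * (- x - y) + (- x - y) * x) = 4 * (- 1 - b\<^sup>2 - c\<^sup>2)"
    "2 * (x * y * (- x - y)) = 2 * (2 * b * c)"
    using assms unfolding chart_equations_def by Groebner_Basis.algebra+
  then have "x * y + y * (- x - y) + (- x - y) * x = - 1 - b\<^sup>2 - c\<^sup>2" "x * y * (- x - y) = 2 * b * c"
    by (metis mult_cancel_left zero_neq_numeral)+
  then show ?thesis
    by (simp add: surface_equations_def chart_nth Let_def flip: b_def c_def)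
qed

lemma normalized_surface_point:
  fixes v :: "'k::field_char_0 ^ 6"
  assumes "surface_equations v" "v $ 4 = 1"
  obtains x y p q where "chart_equations x y p q" "v = chart x y p q"
proof
  define x y z b c where "x = v $ 1" and "y = v $ 2" and "z = v $ 3" and "b = v $ 5" and "c = v $ 6"
  note defs = x_def y_def z_def b_def c_def
  have eqs: "x + y + z = 0" "x * y + y * z + z * x = - 1 - b\<^sup>2 - c\<^sup>2" "x * y * z = 2 * b * c"
    using assms by (simp_all add: surface_equations_def Let_def defs)
  have z: "z = - x - y" using eqs(1) by Groebner_Basis.algebra
  show "chart_equations x y (b + c) (b - c)"
    unfolding chart_equations_def using eqs(2,3) unfolding z by (intro conjI; Groebner_Basis.algebra)
  show "v = chart x y (b + c) (b - c)"
    unfolding vec_eq_iff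
  proof
    fix i :: 6
    show "v $ i = chart x y (b + c) (b - c) $ i"
      using index_cases[of i] z assms(2) by (auto simp: chart_nth simp flip: defs)
  qed
qed

text \<open>The reindexing \<open>\<tau>\<close> lets one chart serve for all three of the
  coordinates \<open>a\<close>, \<open>b\<close>, \<open>c\<close>: permuted chart coordinates are
  still normalizable.\<close>

lemma vanish_on_chart:
  fixes v :: "'k::field_char_0 ^ 6"
  assumes zero: "\<And>w. \<lbrakk>w \<noteq> 0; surface_equations w; \<And>i. w $ i \<in> \<rat>\<rbrakk> \<Longrightarrow> mpoly_value f (\<chi> i. w $ \<tau> i) = 0"
    and "surface_equations v" "v $ 4 = 1"
  shows "mpoly_value f (\<chi> i. v $ \<tau> i) = 0"
proof -
  obtain x y p q where eqs: "chart_equations x y p q" and v: "v = chart x y p q"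
    using normalized_surface_point assms(2,3) by blast
  let ?F = "\<lambda>x y p q. mpoly_value f (\<chi> i. chart x y p q $ \<tau> i)"
  have sum: "normalizable (\<lambda>x y p q. (p + q) / 2)"
    and diff: "normalizable (\<lambda>x y p q. (p - q) / 2)"
    and z: "normalizable (\<lambda>x y p q. - x - y)"
    by (use normalizable_mult[OF normalizable_const[of "1 / 2"] normalizable_add[OF normalizable_coords(3,4)]] in simp)
       (use normalizable_mult[OF normalizable_const[of "1 / 2"] normalizable_add[OF normalizable_coords(3)
          normalizable_mult[OF normalizable_const[of "- 1"] normalizable_coords(4)]]] in simp,
        use normalizable_mult[OF normalizable_const[of "- 1"] normalizable_add[OF normalizable_coords(1,2)]] in simp)
  have coords: "normalizable (\<lambda>x y p q. chart x y p q $ i)" for i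
    using index_cases[of i] normalizable_coords sum diff z normalizable_const[of 1]
    by (auto simp: chart_nth)
  have "normalizable ?F"
    by (rule normalizable_mpoly_value) (simp add: coords)
  moreover have "?F x y p q = 0"
    if "x \<in> \<rat>" "y \<in> \<rat>" "p \<in> \<rat>" "q \<in> \<rat>" "chart_equations x y p q" for x y p q
  proof (rule zero)
    show "chart x y p q \<noteq> 0" using chart_nth(4)[of x y p q] by force
    show "surface_equations (chart x y p q)" using that(5) by (rule surface_equations_chart)
    show "chart x y p q $ i \<in> \<rat>" for i
      using index_cases[of i] that(1-4) by (auto simp: chart_nth)
  qed
  ultimately show ?thesis unfolding v using eqs by (rule normalizable_vanish)
qed

lemma surface_equations_scale:
  fixes v :: "'k::field ^ 6"
  assumes "surface_equations v"
  shows "surface_equations (k *s v)"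
proof -
  define x y z a b c where "x = v $ 1" and "y = v $ 2" and "z = v $ 3"
    and "a = v $ 4" and "b = v $ 5" and "c = v $ 6"
  note defs = x_def y_def z_def a_def b_def c_def
  have eqs: "x + y + z = 0" "x * y + y * z + z * x = - a\<^sup>2 - b\<^sup>2 - c\<^sup>2" "x * y * z = 2 * a * b * c"
    using assms by (simp_all add: surface_equations_def Let_def defs)
  show ?thesis
    unfolding surface_equations_def Let_def vector_smult_component defs[symmetric]
    using eqs by (intro conjI; Groebner_Basis.algebra)
qed

text \<open>Homogeneity allows rescaling a nonzero coordinate among \<open>a\<close>,
  \<open>b\<close>, \<open>c\<close> to 1, and the symmetry of the equations in these three moves it
  to index \<open>4\<close>.\<close>

lemma vanish_on_surface:
  fixes v :: "'k::field_char_0 ^ 6"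
  assumes hom: "homogeneous f"
    and zero: "\<And>w. \<lbrakk>w \<noteq> 0; surface_equations w; \<And>i. w $ i \<in> \<rat>\<rbrakk> \<Longrightarrow> mpoly_value f w = 0"
    and v: "surface_equations v" "v \<noteq> 0"
  shows "mpoly_value f v = 0"
proof -
  have nonzero: "v $ j \<noteq> 0 \<Longrightarrow> mpoly_value f v = 0" if "j \<in> {4, 5, 6}" for j
  proof -
    assume j: "v $ j \<noteq> 0"
    define \<tau> where "\<tau> = Transposition.transpose 4 j"
    define u where "u = inverse (v $ j) *s v"
    have \<tau>: "\<tau> (\<tau> i) = i" for i by (simp add: \<tau>_def)
    have perm: "surface_equations (\<chi> i. w $ \<tau> i)" if "surface_equations w" for w :: "'k ^ 6"
      using that \<open>j \<in> {4, 5, 6}\<close>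
      by (auto simp: surface_equations_def Let_def \<tau>_def transpose_def; Groebner_Basis.algebra)
    have u: "surface_equations u"
      unfolding u_def using v(1) by (rule surface_equations_scale)
    \<comment> \<open>The two reindexings cancel, as \<open>\<tau>\<close> is an involution; the
      inner one brings \<open>u\<close> into the chart.\<close>
    have "mpoly_value f (\<chi> i. (\<chi> i. u $ \<tau> i) $ \<tau> i) = 0"
    proof (rule vanish_on_chart)
      show "surface_equations (\<chi> i. u $ \<tau> i)" using u by (rule perm)
      show "(\<chi> i. u $ \<tau> i) $ 4 = 1" using j by (simp add: u_def \<tau>_def)
      fix w :: "'k ^ 6"
      assume w: "w \<noteq> 0" "surface_equations w" "\<And>i. w $ i \<in> \<rat>"
      show "mpoly_value f (\<chi> i. w $ \<tau> i) = 0"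
      proof (rule zero)
        show "(\<chi> i. w $ \<tau> i) \<noteq> 0" using w(1) by (auto simp: vec_eq_iff) (metis \<tau>)
      qed (use w perm in auto)
    qed
    then have "mpoly_value f u = 0" by (simp add: \<tau>)
    moreover obtain d where d: "\<forall>m\<in>Poly_Mapping.keys f. monom_degree m = d"
      using hom by (auto simp: homogeneous_def)
    ultimately show ?thesis
      using j mpoly_value_scale[OF d] by (simp add: u_def)
  qed
  show ?thesis
  proof (rule ccontr)
    assume "mpoly_value f v \<noteq> 0"
    then have abc: "v $ 4 = 0" "v $ 5 = 0" "v $ 6 = 0" using nonzero by auto
    have xyz: "v $ 1 + v $ 2 + v $ 3 = 0" "v $ 1 * v $ 2 + v $ 2 * v $ 3 + v $ 3 * v $ 1 = 0"
      "v $ 1 * v $ 2 * v $ 3 = 0"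
      using v(1) abc by (simp_all add: surface_equations_def Let_def)
    \<comment> \<open>All elementary symmetric functions of \<open>x\<close>, \<open>y\<close>,
      \<open>z\<close> vanish, so each is a root of \<open>T ^ 3\<close>.\<close>
    have "(v $ 1) ^ 3 = 0" "(v $ 2) ^ 3 = 0" "(v $ 3) ^ 3 = 0" using xyz by Groebner_Basis.algebra+
    then have "v $ i = 0" for i using index_cases[of i] abc by auto
    with v(2) show False by (simp add: vec_eq_iff)
  qed
qed

theorem theorem1:
  shows "(subtopology zariski_topology surface) closure_of (rational_points surface) = surface"
proof
  have sub: "surface \<subseteq> topspace zariski_topology"
    by (auto simp: surface_def proj_space_def)
  then show "(subtopology zariski_topology surface) closure_of (rational_points surface) \<subseteq> surface"
    using closure_of_subset_topspace[of "subtopology zariski_topology surface"] by auto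
  show "surface \<subseteq> (subtopology zariski_topology surface) closure_of (rational_points surface)"
  proof
    fix P assume "P \<in> surface"
    then obtain v where P: "P = proj_point v" and v: "v \<noteq> 0" "surface_equations v"
      by (auto simp: surface_def)
    \<comment> \<open>It suffices to treat an arbitrary closed \<open>C\<close>: the forms cutting
      it out vanish at all rational solutions, hence on the whole surface.\<close>
    have "P \<in> C" if C: "closedin (subtopology zariski_topology surface) C" "rational_points surface \<subseteq> C" for C
    proof -
      obtain Z where "zariski_closed Z" and CZ: "C = Z \<inter> surface"
        using C(1) by (auto simp: closedin_subtopology closedin_zariski)
      then obtain S where S: "\<forall>f\<in>S. homogeneous f" "Z = zero_locus S"
        by (auto simp: zariski_closed_def)
      have "mpoly_value f v = 0" if f: "f \<in> S" for f
      proof (rule vanish_on_surface)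
        show "homogeneous f" using S(1) f by blast
        fix w :: "rat alg_closure ^ 6"
        assume w: "w \<noteq> 0" "surface_equations w" "\<And>i. w $ i \<in> \<rat>"
        then have "proj_point w \<in> rational_points surface"
          using proj_point_self[of w] by (auto simp: rational_points_def surface_def)
        then have "proj_point w \<in> zero_locus S" using C(2) CZ S(2) by blast
        then show "mpoly_value f w = 0"
          using f proj_point_self[of w] by (auto simp: zero_locus_def)
      qed (use v in auto)
      then have "P \<in> zero_locus S"
        using S(1) v(1) proj_point_vanish_iff[of _ v] by (auto simp: zero_locus_def P proj_space_def)
      then show ?thesis using CZ S(2) \<open>P \<in> surface\<close> by blast
    qed
    moreover have "rational_points surface \<subseteq> topspace (subtopology zariski_topology surface)"
      using sub by (auto simp: rational_points_def)
    ultimately show "P \<in> (subtopology zariski_topology surface) closure_of (rational_points surface)"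
      using closedin_closure_of closure_of_subset by metis
  qed
qed

end
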